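(* Let $A, B_2, C_2$ be real matrices of compatible sizes with $(A,B_2)$ stabilizable and $(A,C_2)$ detectable, and let $\mathbf{P}_{22}=C_2(zI-A)^{-1}B_2$ (a strictly proper plant, i.e. $D_{22}=0$). The following statements hold. (1) For any transfer matrices $\mathbf{R},\mathbf{M},\mathbf{N},\mathbf{L}$ satisfying the SLP constraints $$\begin{bmatrix}zI-A & -B_2\end{bmatrix}\begin{bmatrix}\mathbf{R}&\mathbf{N}\\ \mathbf{M}&\mathbf{L}\end{bmatrix}=\begin{bmatrix}I&0\end{bmatrix},\quad \begin{bmatrix}\mathbf{R}&\mathbf{N}\\ \mathbf{M}&\mathbf{L}\end{bmatrix}\begin{bmatrix}zI-A\\ -C_2\end{bmatrix}=\begin{bmatrix}I\\ 0\end{bmatrix},\quad \mathbf{R},\mathbf{M},\mathbf{N}\in\tfrac1z\mathcal{RH}_\infty,\ \mathbf{L}\in\mathcal{RH}_\infty,$$ the transfer matrices $$\mathbf{Y}=C_2\mathbf{N}+I,\quad \mathbf{U}=\mathbf{L},\quad \mathbf{W}=C_2\mathbf{R}B_2,\quad \mathbf{Z}=\mathbf{M}B_2+I$$ satisfy the IOP constraints $$\begin{bmatrix}I&-\mathbf{P}_{22}\end{bmatrix}\begin{bmatrix}\mathbf{Y}&\mathbf{W}\\ \mathbf{U}&\mathbf{Z}\end{bmatrix}=\begin{bmatrix}I&0\end{bmatrix},\quad \begin{bmatrix}\mathbf{Y}&\mathbf{W}\\ \mathbf{U}&\mathbf{Z}\end{bmatrix}\begin{bmatrix}-\mathbf{P}_{22}\\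 I\end{bmatrix}=\begin{bmatrix}0\\ I\end{bmatrix},\quad \mathbf{Y},\mathbf{U},\mathbf{W},\mathbf{Z}\in\mathcal{RH}_\infty,$$ and $\mathbf{L}-\mathbf{M}\mathbf{R}^{-1}\mathbf{N}=\mathbf{U}\mathbf{Y}^{-1}$. (2) For any transfer matrices $\mathbf{Y},\mathbf{U},\mathbf{W},\mathbf{Z}$ satisfying the IOP constraints displayed in (1), the transfer matrices $$\mathbf{R}=(zI-A)^{-1}+(zI-A)^{-1}B_2\mathbf{U}C_2(zI-A)^{-1},\quad \mathbf{M}=\mathbf{U}C_2(zI-A)^{-1},$$ $$\mathbf{N}=(zI-A)^{-1}B_2\mathbf{U},\quad \mathbf{L}=\mathbf{U}$$ satisfy the SLP constraints displayed in (1), and $\mathbf{U}\mathbf{Y}^{-1}=\mathbf{L}-\mathbf{M}\mathbf{R}^{-1}\mathbf{N}$.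
   Context: Discrete-time setting: transfer matrices are matrices of real-rational functions of $z$. $\mathcal{RH}_\infty$ denotes the set of real-rational, proper, stable transfer matrices (all poles in the open unit disk), of whatever size is required; $\tfrac1z\mathcal{RH}_\infty$ denotes the stable and strictly proper ones. $I$ and $0$ denote identity and zero matrices of appropriate sizes. $(A,B_2)$ stabilizable and $(A,C_2)$ detectable are meant in the discrete-time sense. *)

theory Defs
  imports
    "Jordan_Normal_Form.Char_Poly"
    "Jordan_Normal_Form.Gauss_Jordan_Elimination"
    "HOL-Computational_Algebra.Field_as_Ring"
    "HOL-Computational_Algebra.Computational_Algebra"
begin

type_synonym transfer_mat = "real poly fract mat"

definition zvar :: "real poly fract" where
  "zvar = to_fract [:0, 1:]"

abbreviation const_mat :: "real mat \<Rightarrow> transfer_mat" where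
  "const_mat X \<equiv> map_mat (\<lambda>a. to_fract [:a:]) X"

definition zI_minus :: "real mat \<Rightarrow> transfer_mat" where
  "zI_minus A = zvar \<cdot>\<^sub>m 1\<^sub>m (dim_row A) - const_mat A"

text \<open>
  Only meaningful for invertible matrices, since the library inverse is partial; the statement
  therefore asserts invertibility explicitly wherever it is part of the claim.
\<close>

definition mat_inv :: "'a :: field mat \<Rightarrow> 'a mat" where
  "mat_inv X = the (mat_inverse X)"

definition plant :: "real mat \<Rightarrow> real mat \<Rightarrow> real mat \<Rightarrow> transfer_mat" where
  "plant A B C = const_mat C * mat_inv (zI_minus A) * const_mat B"

text \<open>
  The function \<open>quot_of_fract\<close> yields numerator and (monic) denominator in lowest terms, so the
  complex roots of the denominator are exactly the poles.
\<close>

definition is_rat_pole :: "real poly fract \<Rightarrow> complex \<Rightarrow> bool" where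
  "is_rat_pole f w \<longleftrightarrow> poly (map_poly complex_of_real (snd (quot_of_fract f))) w = 0"

definition stable_rat :: "real poly fract \<Rightarrow> bool" where
  "stable_rat f \<longleftrightarrow> (\<forall>w. is_rat_pole f w \<longrightarrow> norm w < 1)"

definition proper_rat :: "real poly fract \<Rightarrow> bool" where
  "proper_rat f \<longleftrightarrow> degree (fst (quot_of_fract f)) \<le> degree (snd (quot_of_fract f))"

text \<open>The zero function is listed separately because \<open>degree 0 = 0\<close>.\<close>

definition strictly_proper_rat :: "real poly fract \<Rightarrow> bool" where
  "strictly_proper_rat f \<longleftrightarrow>
     f = 0 \<or> degree (fst (quot_of_fract f)) < degree (snd (quot_of_fract f))"

definition RH_inf :: "transfer_mat set" where
  "RH_inf = {G. \<forall>f \<in> elements_mat G. proper_rat f \<and> stable_rat f}"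

definition strict_RH_inf :: "transfer_mat set" where
  "strict_RH_inf = {G. \<forall>f \<in> elements_mat G. strictly_proper_rat f \<and> stable_rat f}"

definition schur_stable :: "real mat \<Rightarrow> bool" where
  "schur_stable A \<longleftrightarrow> (\<forall>w. eigenvalue (map_mat complex_of_real A) w \<longrightarrow> norm w < 1)"

definition stabilizable :: "real mat \<Rightarrow> real mat \<Rightarrow> bool" where
  "stabilizable A B \<longleftrightarrow>
     (\<exists>F \<in> carrier_mat (dim_col B) (dim_row A). schur_stable (A + B * F))"

definition detectable :: "real mat \<Rightarrow> real mat \<Rightarrow> bool" where
  "detectable A C \<longleftrightarrow>
     (\<exists>K \<in> carrier_mat (dim_row A) (dim_row C). schur_stable (A + K * C))"

definition append_cols :: "'a :: zero mat \<Rightarrow> 'a mat \<Rightarrow> 'a mat" (infixr "@\<^sub>c" 65) where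
  "X @\<^sub>c Y = four_block_mat X Y (0\<^sub>m 0 (dim_col X)) (0\<^sub>m 0 (dim_col Y))"

definition SLP_constraints ::
  "nat \<Rightarrow> nat \<Rightarrow> nat \<Rightarrow> real mat \<Rightarrow> real mat \<Rightarrow> real mat \<Rightarrow>
   transfer_mat \<Rightarrow> transfer_mat \<Rightarrow> transfer_mat \<Rightarrow> transfer_mat \<Rightarrow> bool" where
  "SLP_constraints n m p A B C R M N L \<longleftrightarrow>
     R \<in> carrier_mat n n \<and> M \<in> carrier_mat m n \<and>
     N \<in> carrier_mat n p \<and> L \<in> carrier_mat m p \<and>
     (zI_minus A @\<^sub>c - const_mat B) * four_block_mat R N M L
       = 1\<^sub>m n @\<^sub>c 0\<^sub>m n p \<and>
     four_block_mat R N M L * (zI_minus A @\<^sub>r - const_mat C)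
       = 1\<^sub>m n @\<^sub>r 0\<^sub>m m n \<and>
     R \<in> strict_RH_inf \<and> M \<in> strict_RH_inf \<and> N \<in> strict_RH_inf \<and> L \<in> RH_inf"

definition IOP_constraints ::
  "nat \<Rightarrow> nat \<Rightarrow> transfer_mat \<Rightarrow>
   transfer_mat \<Rightarrow> transfer_mat \<Rightarrow> transfer_mat \<Rightarrow> transfer_mat \<Rightarrow> bool" where
  "IOP_constraints m p P Y U W Z \<longleftrightarrow>
     Y \<in> carrier_mat p p \<and> U \<in> carrier_mat m p \<and>
     W \<in> carrier_mat p m \<and> Z \<in> carrier_mat m m \<and>
     (1\<^sub>m p @\<^sub>c - P) * four_block_mat Y W U Z = 1\<^sub>m p @\<^sub>c 0\<^sub>m p m \<and>
     four_block_mat Y W U Z * (- P @\<^sub>r 1\<^sub>m m) = 0\<^sub>m p m @\<^sub>r 1\<^sub>m m \<and>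
     Y \<in> RH_inf \<and> U \<in> RH_inf \<and> W \<in> RH_inf \<and> Z \<in> RH_inf"

end

theory Submission
  imports Defs
begin

text \<open>
  Write \<open>\<Phi>\<close> for the inverse of \<open>zI - A\<close>. The SLP equations force \<open>R = \<Phi>(I + BM) = (I + NC)\<Phi>\<close>,
  \<open>N = \<Phi>BL\<close> and \<open>M = LC\<Phi>\<close>, so the algebraic part in both directions is substitution, and
  \<open>(L - M R\<^sup>-\<^sup>1 N)(I + CN) = L\<close> gives equality of the controllers.

  Stability in part (2) is not immediate because \<open>\<Phi>\<close> may be unstable. Choose \<open>F\<close> and \<open>K\<close> such that
  \<open>A + BF\<close> and \<open>A + KC\<close> are Schur stable, with stable strictly proper resolvents \<open>\<Phi>\<^sub>F\<close> and \<open>\<Phi>\<^sub>K\<close>. From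
  \<open>\<Phi> + \<Phi>BF\<Phi>\<^sub>F = \<Phi>\<^sub>F\<close> and \<open>\<Phi> + \<Phi>\<^sub>K KC\<Phi> = \<Phi>\<^sub>K\<close> one gets
  \<open>UC\<Phi> = UC\<Phi>\<^sub>F - (UP)F\<Phi>\<^sub>F\<close>, \<open>\<Phi>BU = \<Phi>\<^sub>K BU - \<Phi>\<^sub>K K(PU)\<close>,
  \<open>RB = \<Phi>BZ = \<Phi>\<^sub>K BZ - \<Phi>\<^sub>K KW\<close> and \<open>R = (I + NC)\<Phi>\<^sub>F - (RB)F\<Phi>\<^sub>F\<close>, whose right-hand sides are stable
  and strictly proper. Since \<open>BM\<close> and \<open>CN\<close> are strictly proper, \<open>I + BM\<close> and \<open>I + CN\<close>, hence \<open>R\<close>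
  and \<open>Y\<close>, are invertible.
\<close>

subsection \<open>Stable and proper rational functions\<close>

lemma sum_closed:
  assumes "P 0" and "\<And>x y. P x \<Longrightarrow> P y \<Longrightarrow> P (x + y)" and "\<And>x. x \<in> S \<Longrightarrow> P (f x)"
  shows "P (sum f S)"
  using assms(3) by (induction S rule: infinite_finite_induct) (auto intro: assms(1,2))

lemma fract_eq_quot:
  "f = to_fract (fst (quot_of_fract f)) / to_fract (snd (quot_of_fract f))"
  by (simp flip: Fract_conv_to_fract)

text \<open>Compares an arbitrary representation \<open>a / b\<close> with the one in lowest terms;
  divisibility and degrees can be read off this polynomial identity.\<close>

lemma quot_of_fract_cross:
  assumes "b \<noteq> 0" and "f = to_fract a / to_fract b"
  shows "fst (quot_of_fract f) * b = a * snd (quot_of_fract f)"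
proof -
  have "to_fract (fst (quot_of_fract f)) / to_fract (snd (quot_of_fract f)) = to_fract a / to_fract b"
    using fract_eq_quot[of f] assms(2) by simp
  then have "to_fract (fst (quot_of_fract f) * b) = to_fract (a * snd (quot_of_fract f))"
    using assms(1) by (simp add: frac_eq_eq)
  then show ?thesis
    by (simp only: to_fract_eq_iff)
qed

lemma map_poly_of_real_mult:
  "map_poly complex_of_real (b * d) = map_poly complex_of_real b * map_poly complex_of_real d"
proof -
  interpret map_poly_comm_ring_hom complex_of_real ..
  show ?thesis
    by (rule hom_mult)
qed

text \<open>Stability may be checked on any representation: the reduced denominator is coprime to
  the reduced numerator, hence divides \<open>b\<close>, so its roots are among those of
  \<open>b\<close>.\<close>

lemma stable_ratI:
  assumes "b \<noteq> 0" and "f = to_fract a / to_fract b"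
    and "\<And>w. poly (map_poly complex_of_real b) w = 0 \<Longrightarrow> norm w < 1"
  shows "stable_rat f"
proof -
  have "snd (quot_of_fract f) dvd fst (quot_of_fract f) * b"
    unfolding quot_of_fract_cross[OF assms(1,2)] by simp
  then have "snd (quot_of_fract f) dvd b"
    using coprime_quot_of_fract[of f] by (simp add: coprime_commute coprime_dvd_mult_right_iff)
  then obtain c where "b = snd (quot_of_fract f) * c" ..
  then show ?thesis
    using assms(3) by (simp add: stable_rat_def is_rat_pole_def map_poly_of_real_mult)
qed

lemma stable_rat_fractE:
  assumes "stable_rat f"
  obtains a b where "b \<noteq> 0" and "f = to_fract a / to_fract b"
    and "\<And>w. poly (map_poly complex_of_real b) w = 0 \<Longrightarrow> norm w < 1"
  using assms fract_eq_quot[of f] snd_quot_of_fract_nonzero[of f]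
  unfolding stable_rat_def is_rat_pole_def by blast

lemma stable_rat_add:
  assumes "stable_rat f" and "stable_rat g"
  shows "stable_rat (f + g)"
proof -
  obtain a b where 1: "b \<noteq> 0" "f = to_fract a / to_fract b"
    "\<And>w. poly (map_poly complex_of_real b) w = 0 \<Longrightarrow> norm w < 1"
    using assms(1) by (rule stable_rat_fractE) blast
  obtain c d where 2: "d \<noteq> 0" "g = to_fract c / to_fract d"
    "\<And>w. poly (map_poly complex_of_real d) w = 0 \<Longrightarrow> norm w < 1"
    using assms(2) by (rule stable_rat_fractE) blast
  have "f + g = to_fract (a * d + c * b) / to_fract (b * d)"
    using 1(1,2) 2(1,2) by (simp add: add_frac_eq)
  then show ?thesis
    by (rule stable_ratI[rotated]) (use 1 2 in \<open>auto simp: map_poly_of_real_mult\<close>)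
qed

lemma stable_rat_mult:
  assumes "stable_rat f" and "stable_rat g"
  shows "stable_rat (f * g)"
proof -
  obtain a b where 1: "b \<noteq> 0" "f = to_fract a / to_fract b"
    "\<And>w. poly (map_poly complex_of_real b) w = 0 \<Longrightarrow> norm w < 1"
    using assms(1) by (rule stable_rat_fractE) blast
  obtain c d where 2: "d \<noteq> 0" "g = to_fract c / to_fract d"
    "\<And>w. poly (map_poly complex_of_real d) w = 0 \<Longrightarrow> norm w < 1"
    using assms(2) by (rule stable_rat_fractE) blast
  have "f * g = to_fract (a * c) / to_fract (b * d)"
    using 1(2) 2(2) by simp
  then show ?thesis
    by (rule stable_ratI[rotated]) (use 1 2 in \<open>auto simp: map_poly_of_real_mult\<close>)
qed

lemma stable_rat_to_fract [simp]: "stable_rat (to_fract a)"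
  by (simp add: stable_rat_def is_rat_pole_def)

section \<open>Degree conditions: proper and strictly proper functions\<close>

text \<open>For nonzero \<open>f\<close> the difference of numerator and denominator degree is the
  same in every representation, as taking degrees in the cross-multiplied identity shows.\<close>

lemma proper_ratI:
  assumes "b \<noteq> 0" and "f = to_fract a / to_fract b" and "degree a \<le> degree b"
  shows "proper_rat f"
proof (cases "f = 0")
  case False
  then have "a \<noteq> 0" and "fst (quot_of_fract f) \<noteq> 0"
    using assms(2) by auto
  then show ?thesis
    using arg_cong[OF quot_of_fract_cross[OF assms(1,2)], of degree] assms(1,3)
    by (simp add: degree_mult_eq proper_rat_def)
qed (simp add: proper_rat_def)

lemma strictly_proper_ratI:
  assumes "b \<noteq> 0" and "f = to_fract a / to_fract b" and "a = 0 \<or> degree a < degree b"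
  shows "strictly_proper_rat f"
proof (cases "f = 0")
  case False
  then have "a \<noteq> 0" and "fst (quot_of_fract f) \<noteq> 0"
    using assms(2) by auto
  then show ?thesis
    using arg_cong[OF quot_of_fract_cross[OF assms(1,2)], of degree] assms(1,3)
    by (simp add: degree_mult_eq strictly_proper_rat_def)
qed (simp add: strictly_proper_rat_def)

lemma proper_rat_add:
  assumes "proper_rat f" and "proper_rat g"
  shows "proper_rat (f + g)"
proof -
  define a b c d where defs: "a = fst (quot_of_fract f)" "b = snd (quot_of_fract f)"
    "c = fst (quot_of_fract g)" "d = snd (quot_of_fract g)"
  have nz: "b \<noteq> 0" "d \<noteq> 0" and deg: "degree a \<le> degree b" "degree c \<le> degree d"
    using assms by (simp_all add: defs proper_rat_def)
  have "f = to_fract a / to_fract b" "g = to_fract c / to_fract d"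
    unfolding defs by (rule fract_eq_quot)+
  then have "f + g = to_fract (a * d + c * b) / to_fract (b * d)"
    using nz by (simp add: add_frac_eq)
  moreover have "degree (a * d + c * b) \<le> degree (b * d)"
    using nz deg degree_mult_le[of a d] degree_mult_le[of c b]
    by (intro degree_add_le) (auto simp: degree_mult_eq)
  ultimately show ?thesis
    using nz by (intro proper_ratI[of "b * d" _ "a * d + c * b"]) auto
qed

lemma strictly_proper_rat_add:
  assumes "strictly_proper_rat f" and "strictly_proper_rat g"
  shows "strictly_proper_rat (f + g)"
proof (cases "f = 0 \<or> g = 0")
  case False
  define a b c d where defs: "a = fst (quot_of_fract f)" "b = snd (quot_of_fract f)"
    "c = fst (quot_of_fract g)" "d = snd (quot_of_fract g)"
  have nz: "b \<noteq> 0" "d \<noteq> 0" and deg: "degree a < degree b" "degree c < degree d"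
    using assms False by (simp_all add: defs strictly_proper_rat_def)
  have "f = to_fract a / to_fract b" "g = to_fract c / to_fract d"
    unfolding defs by (rule fract_eq_quot)+
  then have "f + g = to_fract (a * d + c * b) / to_fract (b * d)"
    using nz by (simp add: add_frac_eq)
  moreover have "degree (a * d + c * b) < degree (b * d)"
    using nz deg degree_mult_le[of a d] degree_mult_le[of c b]
    by (intro degree_add_less) (auto simp: degree_mult_eq)
  ultimately show ?thesis
    using nz by (intro strictly_proper_ratI[of "b * d" _ "a * d + c * b"]) auto
qed (use assms in auto)

lemma proper_rat_mult:
  assumes "proper_rat f" and "proper_rat g"
  shows "proper_rat (f * g)"
proof -
  define a b c d where defs: "a = fst (quot_of_fract f)" "b = snd (quot_of_fract f)"
    "c = fst (quot_of_fract g)" "d = snd (quot_of_fract g)"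
  have nz: "b \<noteq> 0" "d \<noteq> 0" and deg: "degree a \<le> degree b" "degree c \<le> degree d"
    using assms by (simp_all add: defs proper_rat_def)
  have "f = to_fract a / to_fract b" "g = to_fract c / to_fract d"
    unfolding defs by (rule fract_eq_quot)+
  then have "f * g = to_fract (a * c) / to_fract (b * d)"
    by simp
  moreover have "degree (a * c) \<le> degree (b * d)"
    using nz deg degree_mult_le[of a c] by (auto simp: degree_mult_eq)
  ultimately show ?thesis
    using nz by (intro proper_ratI[of "b * d" _ "a * c"]) auto
qed

lemma strictly_proper_rat_mult:
  assumes "strictly_proper_rat f" and "proper_rat g"
  shows "strictly_proper_rat (f * g)"
proof (cases "f = 0")
  case False
  define a b c d where defs: "a = fst (quot_of_fract f)" "b = snd (quot_of_fract f)"
    "c = fst (quot_of_fract g)" "d = snd (quot_of_fract g)"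
  have nz: "b \<noteq> 0" "d \<noteq> 0" and deg: "degree a < degree b" "degree c \<le> degree d"
    using assms False by (simp_all add: defs proper_rat_def strictly_proper_rat_def)
  have "f = to_fract a / to_fract b" "g = to_fract c / to_fract d"
    unfolding defs by (rule fract_eq_quot)+
  then have "f * g = to_fract (a * c) / to_fract (b * d)"
    by simp
  moreover have "degree (a * c) < degree (b * d)"
    using nz deg degree_mult_le[of a c] by (auto simp: degree_mult_eq)
  ultimately show ?thesis
    using nz by (intro strictly_proper_ratI[of "b * d" _ "a * c"]) auto
qed (simp add: strictly_proper_rat_def)

lemma strictly_proper_imp_proper: "strictly_proper_rat f \<Longrightarrow> proper_rat f"
  by (auto simp: strictly_proper_rat_def proper_rat_def)

lemma proper_rat_const [simp]: "proper_rat (to_fract [:c:])"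
  by (simp add: proper_rat_def)

lemma stable_rat_0 [simp]: "stable_rat 0"
  using stable_rat_to_fract[of 0] by simp

subsection \<open>Stable transfer matrices\<close>

lemma RH_infD: "G \<in> RH_inf \<Longrightarrow> i < dim_row G \<Longrightarrow> j < dim_col G \<Longrightarrow>
    proper_rat (G $$ (i, j)) \<and> stable_rat (G $$ (i, j))"
  by (auto simp: RH_inf_def intro!: elements_matI)

lemma strict_RH_infD: "G \<in> strict_RH_inf \<Longrightarrow> i < dim_row G \<Longrightarrow> j < dim_col G \<Longrightarrow>
    strictly_proper_rat (G $$ (i, j)) \<and> stable_rat (G $$ (i, j))"
  by (auto simp: strict_RH_inf_def intro!: elements_matI)

lemma RH_infI: "(\<And>i j. i < dim_row G \<Longrightarrow> j < dim_col G \<Longrightarrow>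
    proper_rat (G $$ (i, j)) \<and> stable_rat (G $$ (i, j))) \<Longrightarrow> G \<in> RH_inf"
  by (auto simp: RH_inf_def)

lemma strict_RH_infI: "(\<And>i j. i < dim_row G \<Longrightarrow> j < dim_col G \<Longrightarrow>
    strictly_proper_rat (G $$ (i, j)) \<and> stable_rat (G $$ (i, j))) \<Longrightarrow> G \<in> strict_RH_inf"
  by (auto simp: strict_RH_inf_def)

lemma strict_RH_inf_imp_RH_inf: "G \<in> strict_RH_inf \<Longrightarrow> G \<in> RH_inf"
  by (auto simp: strict_RH_inf_def RH_inf_def strictly_proper_imp_proper)

lemma const_mat_RH_inf: "const_mat X \<in> RH_inf"
  by (rule RH_infI) simp

lemma one_mat_RH_inf: "1\<^sub>m n \<in> RH_inf"
proof -
  have "const_mat (1\<^sub>m n) = 1\<^sub>m n"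
    by (rule eq_matI) (auto simp: one_pCons[symmetric])
  then show ?thesis
    using const_mat_RH_inf[of "1\<^sub>m n"] by simp
qed

lemma to_fract_minus_one: "to_fract [:-1:] = (-1 :: real poly fract)"
proof -
  have "to_fract [:-1:] = to_fract (-1 :: real poly)"
    by (simp add: one_pCons)
  then show ?thesis
    by simp
qed

lemma uminus_RH_inf:
  assumes "G \<in> RH_inf"
  shows "- G \<in> RH_inf"
proof (rule RH_infI)
  fix i j assume "i < dim_row (- G)" "j < dim_col (- G)"
  then show "proper_rat ((- G) $$ (i, j)) \<and> stable_rat ((- G) $$ (i, j))"
    using RH_infD[OF assms, of i j] proper_rat_mult[OF proper_rat_const[of "-1"], of "G $$ (i, j)"]
      stable_rat_mult[OF stable_rat_to_fract[of "[:-1:]"], of "G $$ (i, j)"]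
    by (simp add: to_fract_minus_one)
qed

lemma add_RH_inf:
  assumes "G \<in> RH_inf" "H \<in> RH_inf" "dim_row G = dim_row H" "dim_col G = dim_col H"
  shows "G + H \<in> RH_inf"
  by (rule RH_infI) (use assms in \<open>auto simp: RH_infD intro!: proper_rat_add stable_rat_add\<close>)

lemma add_strict_RH_inf:
  assumes "G \<in> strict_RH_inf" "H \<in> strict_RH_inf" "dim_row G = dim_row H" "dim_col G = dim_col H"
  shows "G + H \<in> strict_RH_inf"
  by (rule strict_RH_infI)
    (use assms in \<open>auto simp: strict_RH_infD intro!: strictly_proper_rat_add stable_rat_add\<close>)

lemma mult_RH_inf:
  assumes "G \<in> RH_inf" "H \<in> RH_inf" "dim_col G = dim_row H"
  shows "G * H \<in> RH_inf"
proof (rule RH_infI)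
  fix i j assume *: "i < dim_row (G * H)" "j < dim_col (G * H)"
  let ?P = "\<lambda>f. proper_rat f \<and> stable_rat f"
  have "?P (\<Sum>k = 0..<dim_row H. G $$ (i, k) * H $$ (k, j))"
    by (rule sum_closed[where P = ?P])
      (use * assms in \<open>auto simp: proper_rat_def[of 0] RH_infD
        intro!: proper_rat_add stable_rat_add proper_rat_mult stable_rat_mult\<close>)
  then show "?P ((G * H) $$ (i, j))"
    using * assms(3) by (simp add: scalar_prod_def)
qed

lemma mult_strict_RH_inf_left:
  assumes "G \<in> strict_RH_inf" "H \<in> RH_inf" "dim_col G = dim_row H"
  shows "G * H \<in> strict_RH_inf"
proof (rule strict_RH_infI)
  fix i j assume *: "i < dim_row (G * H)" "j < dim_col (G * H)"
  let ?P = "\<lambda>f. strictly_proper_rat f \<and> stable_rat f"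
  have "?P (\<Sum>k = 0..<dim_row H. G $$ (i, k) * H $$ (k, j))"
    by (rule sum_closed[where P = ?P])
      (use * assms in \<open>auto simp: strictly_proper_rat_def[of 0] RH_infD strict_RH_infD
        intro!: strictly_proper_rat_add stable_rat_add strictly_proper_rat_mult stable_rat_mult\<close>)
  then show "?P ((G * H) $$ (i, j))"
    using * assms(3) by (simp add: scalar_prod_def)
qed

lemma mult_strict_RH_inf_right:
  assumes "G \<in> RH_inf" "H \<in> strict_RH_inf" "dim_col G = dim_row H"
  shows "G * H \<in> strict_RH_inf"
proof (rule strict_RH_infI)
  fix i j assume *: "i < dim_row (G * H)" "j < dim_col (G * H)"
  let ?P = "\<lambda>f. strictly_proper_rat f \<and> stable_rat f"
  \<comment> \<open>The factors are swapped so that the strictly proper one comes first, as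
    \<open>strictly_proper_rat_mult\<close> expects.\<close>
  have "?P (\<Sum>k = 0..<dim_row H. H $$ (k, j) * G $$ (i, k))"
    by (rule sum_closed[where P = ?P])
      (use * assms in \<open>auto simp: strictly_proper_rat_def[of 0] RH_infD strict_RH_infD
        intro!: strictly_proper_rat_add stable_rat_add strictly_proper_rat_mult stable_rat_mult\<close>)
  then show "?P ((G * H) $$ (i, j))"
    using * assms(3) by (simp add: scalar_prod_def mult.commute)
qed

lemma uminus_strict_RH_inf:
  assumes "G \<in> strict_RH_inf"
  shows "- G \<in> strict_RH_inf"
proof -
  \<comment> \<open>Negation is multiplication by the stable constant -I, so closure under products
    suffices.\<close>
  have "- G = - 1\<^sub>m (dim_row G) * G"
    by simp
  then show ?thesis
    using mult_strict_RH_inf_right[OF uminus_RH_inf[OF one_mat_RH_inf] assms] by simp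
qed


subsection \<open>Inverses\<close>

text \<open>Over a field a one-sided inverse of a square matrix is two-sided, so \<open>A\<close> is
  a unit of the matrix ring. Hence the partial \<open>mat_inverse\<close> returns a value, and
  uniqueness of inverses identifies it with \<open>B\<close>.\<close>

lemma inverse_mat:
  fixes A :: "'a :: field mat"
  assumes A: "A \<in> carrier_mat n n" and B: "B \<in> carrier_mat n n" and AB: "A * B = 1\<^sub>m n"
  shows "invertible_mat A" and "mat_inv A = B"
proof -
  have BA: "B * A = 1\<^sub>m n"
    by (rule mat_mult_left_right_inverse[OF A B AB])
  show "invertible_mat A"
    using A B AB BA unfolding invertible_mat_def inverts_mat_def by auto
  have "A \<in> Units (ring_mat TYPE('a) n ())"
    using A B AB BA unfolding Units_def ring_mat_def by auto
  then obtain B' where B': "mat_inverse A = Some B'"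
    using mat_inverse(1)[OF A, where b = "()"] by blast
  from mat_inverse(2)[OF A B'] have *: "B' * A = 1\<^sub>m n" "B' \<in> carrier_mat n n"
    by auto
  have "B' = (B' * A) * B"
    using assoc_mult_mat[OF *(2) A B] AB right_mult_one_mat[OF *(2)] by simp
  then show "mat_inv A = B"
    using * B B' by (simp add: mat_inv_def)
qed

text \<open>At infinity \<open>S\<close> vanishes and I + S tends to the identity, so it cannot be
  singular. Applied to BM and CN to invert \<open>R\<close> and \<open>Y\<close>.\<close>

lemma strictly_proper_perturbation_invertible:
  fixes S :: transfer_mat
  assumes S: "S \<in> carrier_mat n n"
    and strict: "\<And>i j. i < n \<Longrightarrow> j < n \<Longrightarrow> strictly_proper_rat (S $$ (i, j))"
  obtains T where "T \<in> carrier_mat n n" and "(1\<^sub>m n + S) * T = 1\<^sub>m n" and "T * (1\<^sub>m n + S) = 1\<^sub>m n"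
proof -
  have IS: "1\<^sub>m n + S \<in> carrier_mat n n"
    using S by simp
  have "det (1\<^sub>m n + S) \<noteq> 0"
  proof
    \<comment> \<open>In a kernel vector, an entry of maximal degree would be a strictly proper combination of
      entries of at most that degree.\<close>
    assume "det (1\<^sub>m n + S) = 0"
    then obtain v where v: "v \<in> carrier_vec n" "v \<noteq> 0\<^sub>v n" "(1\<^sub>m n + S) *\<^sub>v v = 0\<^sub>v n"
      using det_0_iff_vec_prod_zero_field[OF IS] by blast
    \<comment> \<open>\<open>fdeg\<close> is minus the valuation at infinity, except that
      \<open>fdeg 0\<close> is 0 instead of minus infinity; the maximum is therefore taken over the
      nonzero entries only.\<close>
    define fdeg where "fdeg f = int (degree (fst (quot_of_fract f))) -
      int (degree (snd (quot_of_fract f)))" for f :: "real poly fract"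
    have ratio: "proper_rat (f / g)" if "f \<noteq> 0" "g \<noteq> 0" "fdeg f \<le> fdeg g" for f g
    proof (rule proper_ratI)
      let ?a = "fst (quot_of_fract f) * snd (quot_of_fract g)"
      let ?b = "snd (quot_of_fract f) * fst (quot_of_fract g)"
      show "?b \<noteq> 0"
        using that by simp
      show "degree ?a \<le> degree ?b"
        using that by (simp add: degree_mult_eq fdeg_def)
      show "f / g = to_fract ?a / to_fract ?b"
        by (subst fract_eq_quot[of f], subst fract_eq_quot[of g]) simp
    qed
    define I where "I = {i. i < n \<and> v $ i \<noteq> 0}"
    have "I \<noteq> {}"
      using v(1,2) by (auto simp: I_def)
    then have "Max ((\<lambda>i. fdeg (v $ i)) ` I) \<in> (\<lambda>i. fdeg (v $ i)) ` I"
      by (intro Max_in) (auto simp: I_def)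
    then obtain i where i: "i \<in> I" and "fdeg (v $ i) = Max ((\<lambda>i. fdeg (v $ i)) ` I)"
      by auto
    then have max: "fdeg (v $ j) \<le> fdeg (v $ i)" if "j \<in> I" for j
      using that by (auto simp: I_def)
    have i': "i < n" "v $ i \<noteq> 0"
      using i by (auto simp: I_def)
    have "((1\<^sub>m n + S) *\<^sub>v v) $ i = v $ i + (\<Sum>j = 0..<n. S $$ (i, j) * v $ j)"
      using S v(1) i'
      by (simp add: add_mult_distrib_mat_vec[OF one_carrier_mat S v(1)] scalar_prod_def)
    then have "v $ i + (\<Sum>j = 0..<n. S $$ (i, j) * v $ j) = 0"
      using v(3) i' by simp
    \<comment> \<open>Dividing row \<open>i\<close> of the kernel equation by \<open>v $ i\<close>
      makes all quotients proper. The sum is then strictly proper, yet equal to the nonzero constant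
      -1.\<close>
    then have "(\<Sum>j = 0..<n. S $$ (i, j) * (v $ j / v $ i)) = - 1"
      using i'(2) by (simp add: sum_divide_distrib[symmetric] field_simps eq_neg_iff_add_eq_0)
    moreover have "strictly_proper_rat (\<Sum>j = 0..<n. S $$ (i, j) * (v $ j / v $ i))"
    proof (rule sum_closed[where P = strictly_proper_rat])
      fix j assume j: "j \<in> {0..<n}"
      show "strictly_proper_rat (S $$ (i, j) * (v $ j / v $ i))"
      proof (cases "v $ j = 0")
        case False
        then have "proper_rat (v $ j / v $ i)"
          using ratio[OF False i'(2) max] j by (simp add: I_def)
        then show ?thesis
          using strict j i' by (intro strictly_proper_rat_mult) auto
      qed (simp add: strictly_proper_rat_def)
    qed (simp_all add: strictly_proper_rat_add strictly_proper_rat_def[of 0])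
    ultimately have "strictly_proper_rat (to_fract [:-1:])"
      by (simp add: to_fract_minus_one)
    then show False
      by (simp add: strictly_proper_rat_def)
  qed
  from det_non_zero_imp_unit[OF IS this, of "()"] show ?thesis
    by (auto simp: Units_def ring_mat_def intro: that)
qed

section \<open>The resolvent of a real matrix\<close>

lemma zI_minus_conv_char_poly_matrix: "zI_minus A = map_mat to_fract (char_poly_matrix A)"
  if "A \<in> carrier_mat n n"
  by (rule eq_matI) (use that in \<open>auto simp: zI_minus_def zvar_def char_poly_matrix_def
    simp flip: to_fract_diff to_fract_uminus\<close>)

lemma zI_minus_carrier: "A \<in> carrier_mat n n \<Longrightarrow> zI_minus A \<in> carrier_mat n n"
  by (auto simp: zI_minus_def)

text \<open>Cramer's rule: the inverse is the adjugate of the polynomial matrix zI - A divided by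
  the characteristic polynomial. Degrees give strict properness, and the roots of the denominator
  are the eigenvalues of \<open>A\<close>.\<close>

lemma zI_minus_inverse:
  assumes A: "A \<in> carrier_mat n n"
  obtains J where "J \<in> carrier_mat n n" and "zI_minus A * J = 1\<^sub>m n" and "J * zI_minus A = 1\<^sub>m n"
    and "schur_stable A \<Longrightarrow> J \<in> strict_RH_inf"
proof -
  interpret to_fract_hom: comm_ring_hom "to_fract :: real poly \<Rightarrow> _"
    by unfold_locales auto
  define Q \<chi> where "Q = char_poly_matrix A" and "\<chi> = char_poly A"
  have Q: "Q \<in> carrier_mat n n" and adj: "adj_mat Q \<in> carrier_mat n n"
    using A by (simp_all add: Q_def adj_mat)
  have \<chi>: "\<chi> \<noteq> 0" "degree \<chi> = n"
    using degree_monic_char_poly[OF A] by (auto simp: \<chi>_def)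
  have X: "zI_minus A = map_mat to_fract Q"
    unfolding Q_def by (rule zI_minus_conv_char_poly_matrix[OF A])
  have "Q * adj_mat Q = \<chi> \<cdot>\<^sub>m 1\<^sub>m n"
    using adj_mat(2)[OF Q] by (simp add: \<chi>_def Q_def char_poly_def)
  moreover have "map_mat to_fract (\<chi> \<cdot>\<^sub>m 1\<^sub>m n) = to_fract \<chi> \<cdot>\<^sub>m 1\<^sub>m n"
    by (rule eq_matI) auto
  ultimately have *: "zI_minus A * map_mat to_fract (adj_mat Q) = to_fract \<chi> \<cdot>\<^sub>m 1\<^sub>m n"
    using to_fract_hom.mat_hom_mult[OF Q adj] unfolding X by auto
  define J where "J = (1 / to_fract \<chi>) \<cdot>\<^sub>m map_mat to_fract (adj_mat Q)"
  have J: "J \<in> carrier_mat n n"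
    using adj by (simp add: J_def)
  have XJ: "zI_minus A * J = 1\<^sub>m n"
    unfolding J_def
    by (subst mult_smult_distrib[of _ n n _ n]) (use A adj * \<chi> zI_minus_carrier[OF A] in \<open>auto\<close>)
  have "J \<in> strict_RH_inf" if stab: "schur_stable A"
  proof (rule strict_RH_infI)
    fix i j assume "i < dim_row J" "j < dim_col J"
    then have ij: "i < n" "j < n"
      using J by auto
    then have eq: "J $$ (i, j) = to_fract (adj_mat Q $$ (i, j)) / to_fract \<chi>"
      using adj by (simp add: J_def)
    have "degree (adj_mat Q $$ (i, j)) \<le> 1 * (n - 1)"
    proof -
      \<comment> \<open>Up to sign, an adjugate entry is a minor of size n - 1 in entries of degree
        at most 1.\<close>
      have "degree (det (mat_delete Q j i)) \<le> 1 * (n - 1)"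
      proof (rule degree_det_le)
        show "mat_delete Q j i \<in> carrier_mat (n - 1) (n - 1)"
          using Q by (rule mat_delete_carrier)
        show "degree (mat_delete Q j i $$ (i', j')) \<le> 1" if "i' < n - 1" "j' < n - 1" for i' j'
          using that A by (auto simp: mat_delete_def Q_def char_poly_matrix_def)
      qed
      moreover have "degree ((-1) ^ k * p) = degree p" for k :: nat and p :: "real poly"
        by (cases "even k") auto
      ultimately show ?thesis
        using ij Q by (simp add: adj_mat_def cofactor_def)
    qed
    \<comment> \<open>The index bound \<open>i < n\<close> excludes n = 0, so the truncated
      difference n - 1 really lies below n, the degree of \<open>\<chi>\<close>.\<close>
    then have "degree (adj_mat Q $$ (i, j)) < degree \<chi>"
      using \<chi>(2) ij by linarith
    then have "strictly_proper_rat (J $$ (i, j))"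
      using \<chi>(1) eq by (intro strictly_proper_ratI[of \<chi>]) auto
    moreover have "stable_rat (J $$ (i, j))"
    proof (rule stable_ratI[OF \<chi>(1) eq])
      fix w assume "poly (map_poly complex_of_real \<chi>) w = 0"
      then have "eigenvalue (map_mat complex_of_real A) w"
        using A by (simp add: eigenvalue_root_char_poly[of _ n] \<chi>_def of_real_hom.char_poly_hom[OF A])
      then show "norm w < 1"
        using stab by (simp add: schur_stable_def)
    qed
    ultimately show "strictly_proper_rat (J $$ (i, j)) \<and> stable_rat (J $$ (i, j))" ..
  qed
  then show ?thesis
    using that[OF J XJ] mat_mult_left_right_inverse[OF zI_minus_carrier[OF A] J XJ] by blast
qed


subsection \<open>The constraints as matrix equations\<close>

lemma four_block_mat_eq_iff:
  assumes "A \<in> carrier_mat nr1 nc1" "A' \<in> carrier_mat nr1 nc1"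
    "B \<in> carrier_mat nr1 nc2" "B' \<in> carrier_mat nr1 nc2"
    "C \<in> carrier_mat nr2 nc1" "C' \<in> carrier_mat nr2 nc1"
    "D \<in> carrier_mat nr2 nc2" "D' \<in> carrier_mat nr2 nc2"
  shows "four_block_mat A B C D = four_block_mat A' B' C' D' \<longleftrightarrow>
    A = A' \<and> B = B' \<and> C = C' \<and> D = D'"
proof
  assume *: "four_block_mat A B C D = four_block_mat A' B' C' D'"
  have idx: "four_block_mat A B C D $$ (i, j) = four_block_mat A' B' C' D' $$ (i, j)" for i j
    using * by simp
  have "A $$ (i, j) = A' $$ (i, j)" if "i < nr1" "j < nc1" for i j
    using idx[of i j] that assms by auto
  moreover have "B $$ (i, j) = B' $$ (i, j)" if "i < nr1" "j < nc2" for i j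
    using idx[of i "nc1 + j"] that assms by auto
  moreover have "C $$ (i, j) = C' $$ (i, j)" if "i < nr2" "j < nc1" for i j
    using idx[of "nr1 + i" j] that assms by auto
  moreover have "D $$ (i, j) = D' $$ (i, j)" if "i < nr2" "j < nc2" for i j
    using idx[of "nr1 + i" "nc1 + j"] that assms by auto
  ultimately show "A = A' \<and> B = B' \<and> C = C' \<and> D = D'"
    using assms by (auto intro!: eq_matI)
qed simp

lemma mat_add_uminus_eq_iff:
  fixes A B D :: "'a :: ring mat"
  assumes "A \<in> carrier_mat nr nc" "B \<in> carrier_mat nr nc" "D \<in> carrier_mat nr nc"
  shows "A + - B = D \<longleftrightarrow> A = D + B"
proof
  assume "A + - B = D"
  then have "D + B = A + - B + B"
    by simp
  also have "\<dots> = A"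
    using assms by (intro eq_matI) auto
  finally show "A = D + B" ..
qed (use assms in \<open>auto intro!: eq_matI\<close>)

text \<open>A row of two blocks is a four-block matrix whose lower blocks have no rows, so block
  multiplication applies and the result is compared block by block.\<close>

lemma append_cols_mult_eq_iff:
  assumes "X \<in> carrier_mat n a" "Y \<in> carrier_mat n b" "R \<in> carrier_mat a k" "N \<in> carrier_mat a l"
    "M \<in> carrier_mat b k" "L \<in> carrier_mat b l" "P \<in> carrier_mat n k" "Q \<in> carrier_mat n l"
  shows "(X @\<^sub>c Y) * four_block_mat R N M L = P @\<^sub>c Q \<longleftrightarrow> X * R + Y * M = P \<and> X * N + Y * L = Q"
proof -
  have "(X @\<^sub>c Y) * four_block_mat R N M L =
      four_block_mat (X * R + Y * M) (X * N + Y * L) (0\<^sub>m 0 k) (0\<^sub>m 0 l)"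
    unfolding append_cols_def
    by (subst mult_four_block_mat[of _ n a _ b _ 0 _ _ k _ l]) (use assms in auto)
  then show ?thesis
    unfolding append_cols_def
    by (simp, subst four_block_mat_eq_iff[of _ n k _ _ l _ _ 0]) (use assms in auto)
qed

lemma mult_append_rows_eq_iff:
  fixes X :: "'a :: comm_ring_1 mat"
  assumes "X \<in> carrier_mat a n" "Y \<in> carrier_mat b n" "R \<in> carrier_mat k a" "N \<in> carrier_mat k b"
    "M \<in> carrier_mat l a" "L \<in> carrier_mat l b" "P \<in> carrier_mat k n" "Q \<in> carrier_mat l n"
  shows "four_block_mat R N M L * (X @\<^sub>r Y) = P @\<^sub>r Q \<longleftrightarrow> R * X + N * Y = P \<and> M * X + L * Y = Q"
proof -
  have "four_block_mat R N M L * (X @\<^sub>r Y) =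
      four_block_mat (R * X + N * Y) (0\<^sub>m k 0) (M * X + L * Y) (0\<^sub>m l 0)"
    unfolding append_rows_def
    by (subst mult_four_block_mat[of _ k a _ b _ l _ _ n _ 0]) (use assms in auto)
  then show ?thesis
    unfolding append_rows_def
    by (simp, subst four_block_mat_eq_iff[of _ k n _ _ 0 _ _ l]) (use assms in auto)
qed

text \<open>The working form of the constraints: four separate equations with the negated blocks
  moved to the other side. Both sides contain the dimension conditions, so only matrices satisfying
  them need an argument.\<close>

lemma SLP_constraints_iff:
  assumes "A \<in> carrier_mat n n" "B \<in> carrier_mat n m" "C \<in> carrier_mat p n"
  shows "SLP_constraints n m p A B C R M N L \<longleftrightarrow>
     R \<in> carrier_mat n n \<and> M \<in> carrier_mat m n \<and> N \<in> carrier_mat n p \<and> L \<in> carrier_mat m p \<and>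
     zI_minus A * R = 1\<^sub>m n + const_mat B * M \<and> zI_minus A * N = const_mat B * L \<and>
     R * zI_minus A = 1\<^sub>m n + N * const_mat C \<and> M * zI_minus A = L * const_mat C \<and>
     R \<in> strict_RH_inf \<and> M \<in> strict_RH_inf \<and> N \<in> strict_RH_inf \<and> L \<in> RH_inf"
proof (cases "R \<in> carrier_mat n n \<and> M \<in> carrier_mat m n \<and> N \<in> carrier_mat n p \<and> L \<in> carrier_mat m p")
  case True
  then have c: "R \<in> carrier_mat n n" "M \<in> carrier_mat m n" "N \<in> carrier_mat n p" "L \<in> carrier_mat m p"
    by auto
  let ?X = "zI_minus A" and ?B = "const_mat B" and ?C = "const_mat C"
  have X: "?X \<in> carrier_mat n n" and BC: "?B \<in> carrier_mat n m" "?C \<in> carrier_mat p n"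
    using assms by (auto intro: zI_minus_carrier)
  have "(?X @\<^sub>c - ?B) * four_block_mat R N M L = 1\<^sub>m n @\<^sub>c 0\<^sub>m n p \<longleftrightarrow>
      ?X * R + - (?B * M) = 1\<^sub>m n \<and> ?X * N + - (?B * L) = 0\<^sub>m n p"
    using c X BC by (subst append_cols_mult_eq_iff[of _ n n _ m _ n _ p]) auto
  also have "\<dots> \<longleftrightarrow> ?X * R = 1\<^sub>m n + ?B * M \<and> ?X * N = ?B * L"
    using c X BC mat_add_uminus_eq_iff[of "?X * R" n n "?B * M" "1\<^sub>m n"]
      mat_add_uminus_eq_iff[of "?X * N" n p "?B * L" "0\<^sub>m n p"] by simp
  moreover have "four_block_mat R N M L * (?X @\<^sub>r - ?C) = 1\<^sub>m n @\<^sub>r 0\<^sub>m m n \<longleftrightarrow>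
      R * ?X + - (N * ?C) = 1\<^sub>m n \<and> M * ?X + - (L * ?C) = 0\<^sub>m m n"
    using c X BC by (subst mult_append_rows_eq_iff[of _ n n _ p _ n _ _ m]) auto
  moreover have "\<dots> \<longleftrightarrow> R * ?X = 1\<^sub>m n + N * ?C \<and> M * ?X = L * ?C"
    using c X BC mat_add_uminus_eq_iff[of "R * ?X" n n "N * ?C" "1\<^sub>m n"]
      mat_add_uminus_eq_iff[of "M * ?X" m n "L * ?C" "0\<^sub>m m n"] by simp
  ultimately show ?thesis
    by (simp add: SLP_constraints_def)
qed (auto simp: SLP_constraints_def)

lemma IOP_constraints_iff:
  assumes P: "P \<in> carrier_mat p m"
  shows "IOP_constraints m p P Y U W Z \<longleftrightarrow>
     Y \<in> carrier_mat p p \<and> U \<in> carrier_mat m p \<and> W \<in> carrier_mat p m \<and> Z \<in> carrier_mat m m \<and>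
     Y = 1\<^sub>m p + P * U \<and> W = P * Z \<and> W = Y * P \<and> Z = 1\<^sub>m m + U * P \<and>
     Y \<in> RH_inf \<and> U \<in> RH_inf \<and> W \<in> RH_inf \<and> Z \<in> RH_inf"
proof (cases "Y \<in> carrier_mat p p \<and> U \<in> carrier_mat m p \<and> W \<in> carrier_mat p m \<and> Z \<in> carrier_mat m m")
  case True
  then have c: "Y \<in> carrier_mat p p" "U \<in> carrier_mat m p" "W \<in> carrier_mat p m" "Z \<in> carrier_mat m m"
    by auto
  have "(1\<^sub>m p @\<^sub>c - P) * four_block_mat Y W U Z = 1\<^sub>m p @\<^sub>c 0\<^sub>m p m \<longleftrightarrow>
      Y + - (P * U) = 1\<^sub>m p \<and> W + - (P * Z) = 0\<^sub>m p m"
    using c P by (subst append_cols_mult_eq_iff[of _ p p _ m _ p _ m]) auto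
  also have "\<dots> \<longleftrightarrow> Y = 1\<^sub>m p + P * U \<and> W = P * Z"
    using c P mat_add_uminus_eq_iff[of Y p p "P * U" "1\<^sub>m p"]
      mat_add_uminus_eq_iff[of W p m "P * Z" "0\<^sub>m p m"] by simp
  \<comment> \<open>Block multiplication produces \<open>- (Y * P) + W\<close> and
    \<open>- (U * P) + Z\<close>; the summands are swapped to fit
    \<open>mat_add_uminus_eq_iff\<close>.\<close>
  moreover have "four_block_mat Y W U Z * (- P @\<^sub>r 1\<^sub>m m) = 0\<^sub>m p m @\<^sub>r 1\<^sub>m m \<longleftrightarrow>
      W + - (Y * P) = 0\<^sub>m p m \<and> Z + - (U * P) = 1\<^sub>m m"
    using c P by (subst mult_append_rows_eq_iff[of _ p m _ m _ p _ _ m])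
      (auto simp: comm_add_mat[of "- (Y * P)" p m] comm_add_mat[of "- (U * P)" m m])
  moreover have "\<dots> \<longleftrightarrow> W = Y * P \<and> Z = 1\<^sub>m m + U * P"
    using c P mat_add_uminus_eq_iff[of W p m "Y * P" "0\<^sub>m p m"]
      mat_add_uminus_eq_iff[of Z m m "U * P" "1\<^sub>m m"] by simp
  ultimately show ?thesis
    by (auto simp: IOP_constraints_def)
qed (auto simp: IOP_constraints_def)


subsection \<open>Closed-loop responses\<close>

text \<open>
  The library laws have carrier premises whose dimensions do not all occur in the equation; with
  premises on dimensions instead, they can be used as conditional rewrite rules.
\<close>

lemma mult_assoc_dim:
  fixes A B C :: "'a :: semiring_0 mat"
  shows "dim_col A = dim_row B \<Longrightarrow> dim_col B = dim_row C \<Longrightarrow> (A * B) * C = A * (B * C)"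
  by (rule assoc_mult_mat[of _ "dim_row A" "dim_col A" _ "dim_col B" _ "dim_col C"]) auto

lemma add_mult_distrib_dim:
  fixes A B C :: "'a :: semiring_0 mat"
  shows "dim_row A = dim_row B \<Longrightarrow> dim_col A = dim_col B \<Longrightarrow> dim_col A = dim_row C \<Longrightarrow>
    (A + B) * C = A * C + B * C"
  by (rule add_mult_distrib_mat[of _ "dim_row A" "dim_col A" _ _ "dim_col C"]) auto

lemma mult_add_distrib_dim:
  fixes A B C :: "'a :: semiring_0 mat"
  shows "dim_row B = dim_row C \<Longrightarrow> dim_col B = dim_col C \<Longrightarrow> dim_col A = dim_row B \<Longrightarrow>
    A * (B + C) = A * B + A * C"
  by (rule mult_add_distrib_mat[of _ "dim_row A" "dim_col A" _ "dim_col C"]) auto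

lemma add_commute_dim:
  fixes A B :: "'a :: ab_semigroup_add mat"
  shows "dim_row A = dim_row B \<Longrightarrow> dim_col A = dim_col B \<Longrightarrow> A + B = B + A"
  by (rule eq_matI) (auto simp: add.commute)

lemmas mat_dim_simps = mult_assoc_dim add_mult_distrib_dim mult_add_distrib_dim

text \<open>Products are normalized by associating to the right, where an inverse pair at the front
  appears in this shape.\<close>

lemma mult_cancel_left_dim:
  assumes "A * B = 1\<^sub>m n" and "dim_col A = dim_row B" and "dim_col B = dim_row D" and "dim_row D = n"
  shows "A * (B * D) = (D :: 'a :: comm_ring_1 mat)"
  using assms by (simp flip: mult_assoc_dim)

text \<open>Reads the stability of an unknown response \<open>G\<close> off an identity whose other
  two terms are already known to be stable and strictly proper.\<close>

lemma strict_RH_inf_if_add_eq: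
  assumes "G + H = K" and "H \<in> strict_RH_inf" and "K \<in> strict_RH_inf"
    and "dim_row G = dim_row H" and "dim_col G = dim_col H"
  shows "G \<in> strict_RH_inf"
proof -
  have "G = K + - H"
    using assms(1,4,5) by (auto intro!: eq_matI)
  moreover have "dim_row K = dim_row H" "dim_col K = dim_col H"
    using assms(1) by auto
  ultimately show ?thesis
    using add_strict_RH_inf[OF assms(3) uminus_strict_RH_inf[OF assms(2)]] by simp
qed

lemma RH_inf_if_add_eq:
  assumes "G + H = K" and "G \<in> RH_inf" and "K \<in> RH_inf"
    and "dim_row G = dim_row H" and "dim_col G = dim_col H"
  shows "H \<in> RH_inf"
proof -
  have "H = K + - G"
    using assms(1,4,5) by (auto intro!: eq_matI)
  moreover have "dim_row K = dim_row G" "dim_col K = dim_col G"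
    using assms(1,4,5) by auto
  ultimately show ?thesis
    using add_RH_inf[OF assms(3) uminus_RH_inf[OF assms(2)]] by simp
qed

text \<open>Multiply on the right by Y = I + CN. Since NY = (I + NC)N = RXN, the inverse of
  \<open>R\<close> cancels and the subtracted term becomes MXN = LCN, leaving L(I + CN) - LCN =
  L.\<close>

lemma controller_realizations_eq:
  fixes X R M N L C :: "'a :: field mat"
  assumes c: "X \<in> carrier_mat n n" "R \<in> carrier_mat n n" "M \<in> carrier_mat m n"
    "N \<in> carrier_mat n p" "L \<in> carrier_mat m p" "C \<in> carrier_mat p n"
    and Ri: "Ri \<in> carrier_mat n n" "Ri * R = 1\<^sub>m n"
    and Yi: "Yi \<in> carrier_mat p p" "(1\<^sub>m p + C * N) * Yi = 1\<^sub>m p"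
    and RX: "R * X = 1\<^sub>m n + N * C" and MX: "M * X = L * C"
  shows "L - M * Ri * N = L * Yi"
proof -
  let ?Y = "1\<^sub>m p + C * N"
  have Y: "?Y \<in> carrier_mat p p"
    using c by simp
  have "(M * Ri * N) * ?Y = M * (Ri * ((1\<^sub>m n + N * C) * N))"
    using c Ri(1) by (simp add: mat_dim_simps)
  also have "(1\<^sub>m n + N * C) * N = R * (X * N)"
    unfolding RX[symmetric] using c by (simp add: mult_assoc_dim)
  also have "Ri * (R * (X * N)) = X * N"
    by (rule mult_cancel_left_dim[OF Ri(2)]) (use c Ri(1) in auto)
  also have "M * (X * N) = (M * X) * N"
    using c by (simp add: mult_assoc_dim)
  also have "\<dots> = L * (C * N)"
    unfolding MX using c by (simp add: mult_assoc_dim)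
  finally have *: "(M * Ri * N) * ?Y = L * (C * N)" .
  have "(L - M * Ri * N) * ?Y = L * ?Y - (M * Ri * N) * ?Y"
    by (rule minus_mult_distrib_mat[OF _ _ Y]) (use c Ri in auto)
  also have "\<dots> = L"
    unfolding * using c by (simp add: mult_add_distrib_dim) (auto intro!: eq_matI)
  finally have **: "(L - M * Ri * N) * ?Y = L" .
  have G: "L - M * Ri * N \<in> carrier_mat m p"
    using c Ri(1) by auto
  have "L - M * Ri * N = (L - M * Ri * N) * (?Y * Yi)"
    unfolding Yi(2) by (rule right_mult_one_mat[OF G, symmetric])
  also have "\<dots> = (L - M * Ri * N) * ?Y * Yi"
    by (rule assoc_mult_mat[OF G Y Yi(1), symmetric])
  finally show ?thesis
    unfolding ** .
qed

section \<open>Resolvents under constant feedback\<close>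

lemma const_mat_hom:
  "X \<in> carrier_mat nr n \<Longrightarrow> Y \<in> carrier_mat n nc \<Longrightarrow> const_mat (X * Y) = const_mat X * const_mat Y"
proof -
  interpret comm_ring_hom "\<lambda>a :: real. to_fract [:a:]"
    by unfold_locales (auto simp: one_pCons[symmetric] simp flip: to_fract_add to_fract_mult)
  show "X \<in> carrier_mat nr n \<Longrightarrow> Y \<in> carrier_mat n nc \<Longrightarrow> ?thesis"
    by (rule mat_hom_mult)
qed

text \<open>Used with \<open>D\<close> equal to \<open>B * F\<close> and to \<open>K * C\<close>, to
  compare the resolvent of \<open>A\<close> with the stable ones.\<close>

lemma zI_minus_add:
  assumes "A \<in> carrier_mat n n" "D \<in> carrier_mat n n"
  shows "zI_minus A = zI_minus (A + D) + const_mat D"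
proof -
  have "to_fract [:a + d:] = to_fract [:a:] + to_fract [:d:]" for a d :: real
    by (simp flip: to_fract_add)
  then show ?thesis
    using assms by (intro eq_matI) (auto simp: zI_minus_def)
qed

text \<open>The resolvent identity: expand J X J' once by J X = I and once by X = X' + D.\<close>

lemma shifted_inverse_right:
  fixes X X' D J J' :: "'a :: field mat"
  assumes "X = X' + D" and "J * X = 1\<^sub>m n" and "X' * J' = 1\<^sub>m n"
    and c: "X \<in> carrier_mat n n" "X' \<in> carrier_mat n n" "D \<in> carrier_mat n n"
      "J \<in> carrier_mat n n" "J' \<in> carrier_mat n n"
  shows "J + J * (D * J') = J'"
proof -
  have "J' = J * (X * J')"
    using mult_cancel_left_dim[OF assms(2), of J'] c by auto
  also have "X * J' = 1\<^sub>m n + D * J'"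
    unfolding assms(1) using c assms(3) by (simp add: add_mult_distrib_dim)
  finally show ?thesis
    using c by (simp add: mult_add_distrib_dim)
qed

text \<open>The mirror image, from J' X J; here \<open>J'\<close> ends up on the left of the
  correction term.\<close>

lemma shifted_inverse_left:
  fixes X X' D J J' :: "'a :: field mat"
  assumes "X = X' + D" and "X * J = 1\<^sub>m n" and "J' * X' = 1\<^sub>m n"
    and c: "X \<in> carrier_mat n n" "X' \<in> carrier_mat n n" "D \<in> carrier_mat n n"
      "J \<in> carrier_mat n n" "J' \<in> carrier_mat n n"
  shows "J + J' * (D * J) = J'"
proof -
  have "J' = (J' * X) * J"
    using assms(2) c by (simp add: mult_assoc_dim)
  also have "J' * X = 1\<^sub>m n + J' * D"
    unfolding assms(1) using c assms(3) by (simp add: mult_add_distrib_dim)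
  finally show ?thesis
    using c by (simp add: add_mult_distrib_dim mult_assoc_dim)
qed

text \<open>The core of part (2). The identity for \<open>F\<close> trades a possibly unstable
  \<open>J\<close> at the right end of a response for \<open>J\<^sub>F\<close>, the one for
  \<open>K\<close> trades a \<open>J\<close> at the left end for \<open>J\<^sub>K\<close>. The
  correction terms contain \<open>J\<close> only through PU, UP, W and RB. The last response has
  \<open>J\<close> at both ends and needs both trades in turn.\<close>

lemma IOP_response_strict:
  fixes J J\<^sub>F J\<^sub>K B C F K :: transfer_mat
  defines "P \<equiv> C * J * B"
  assumes c: "J \<in> carrier_mat n n" "J\<^sub>F \<in> carrier_mat n n" "J\<^sub>K \<in> carrier_mat n n"
    "B \<in> carrier_mat n m" "C \<in> carrier_mat p n" "F \<in> carrier_mat m n" "K \<in> carrier_mat n p"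
    and U: "U \<in> carrier_mat m p"
    and F: "J + J * (B * F * J\<^sub>F) = J\<^sub>F" and K: "J + J\<^sub>K * (K * C * J) = J\<^sub>K"
    and strict: "J\<^sub>F \<in> strict_RH_inf" "J\<^sub>K \<in> strict_RH_inf"
    and RH: "B \<in> RH_inf" "C \<in> RH_inf" "F \<in> RH_inf" "K \<in> RH_inf" "U \<in> RH_inf"
    and Y: "1\<^sub>m p + P * U \<in> RH_inf" and Z: "1\<^sub>m m + U * P \<in> RH_inf"
    and W: "P * (1\<^sub>m m + U * P) \<in> RH_inf"
  shows "U * C * J \<in> strict_RH_inf" and "J * B * U \<in> strict_RH_inf"
    and "J + J * B * U * C * J \<in> strict_RH_inf"
proof -
  have P: "P \<in> carrier_mat p m"
    using c by (auto simp: P_def)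
  note dims = carrier_matD[OF P] carrier_matD[OF U] c[THEN carrier_matD(1)] c[THEN carrier_matD(2)]
  \<comment> \<open>UP = Z - I and PU = Y - I are differences of stable matrices.\<close>
  have UP: "U * P \<in> RH_inf"
    by (rule RH_inf_if_add_eq[OF refl one_mat_RH_inf Z]) (simp_all add: dims)
  have PU: "P * U \<in> RH_inf"
    by (rule RH_inf_if_add_eq[OF refl one_mat_RH_inf Y]) (simp_all add: dims)
  have "U * C * J + U * P * (F * J\<^sub>F) = U * C * (J + J * (B * F * J\<^sub>F))"
    using dims by (simp add: P_def mat_dim_simps)
  then have "U * C * J + U * P * (F * J\<^sub>F) = U * C * J\<^sub>F"
    unfolding F .
  then show "U * C * J \<in> strict_RH_inf"
    by (rule strict_RH_inf_if_add_eq[OF _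
        mult_strict_RH_inf_right[OF UP mult_strict_RH_inf_right[OF RH(3) strict(1)]]
        mult_strict_RH_inf_right[OF mult_RH_inf[OF RH(5,2)] strict(1)]]) (simp_all add: dims)
  \<comment> \<open>The identity for \<open>K\<close> times BV on the right, with CJB folded into
    \<open>P\<close>. It serves V = U, with correction through PU, and V = I + UP, with correction
    through W.\<close>
  have *: "J * (B * V) + J\<^sub>K * (K * (P * V)) = J\<^sub>K * (B * V)" if "dim_row V = m" for V
  proof -
    have "J * (B * V) + J\<^sub>K * (K * (P * V)) = (J + J\<^sub>K * (K * C * J)) * (B * V)"
      using dims that by (simp add: P_def mult_assoc_dim add_mult_distrib_dim)
    then show ?thesis
      unfolding K .
  qed
  have "J * (B * U) \<in> strict_RH_inf"
    by (rule strict_RH_inf_if_add_eq[OF *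
        mult_strict_RH_inf_left[OF strict(2) mult_RH_inf[OF RH(4) PU]]
        mult_strict_RH_inf_left[OF strict(2) mult_RH_inf[OF RH(1,5)]]]) (simp_all add: dims)
  then show N: "J * B * U \<in> strict_RH_inf"
    using dims by (simp add: mult_assoc_dim)
  let ?R = "J + J * B * U * C * J"
  \<comment> \<open>First trade for R: its left \<open>J\<close> is treated in RB = JBZ, where the
    right one is absorbed into Z = I + UP.\<close>
  have "J * (B * (1\<^sub>m m + U * P)) \<in> strict_RH_inf"
    by (rule strict_RH_inf_if_add_eq[OF *
        mult_strict_RH_inf_left[OF strict(2) mult_RH_inf[OF RH(4) W]]
        mult_strict_RH_inf_left[OF strict(2) mult_RH_inf[OF RH(1) Z]]]) (simp_all add: dims)
  also have "J * (B * (1\<^sub>m m + U * P)) = ?R * B"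
    using dims by (simp add: P_def mat_dim_simps)
  finally have RB: "?R * B \<in> RH_inf"
    by (rule strict_RH_inf_imp_RH_inf)
  have R: "?R = (1\<^sub>m n + J * B * U * C) * J"
    using dims by (simp add: mat_dim_simps)
  \<comment> \<open>Second trade: the identity for \<open>F\<close> times I + NC on the left, where
    N = JBU and R = (I + NC)J. The correction RB is now known to be stable.\<close>
  have "?R + ?R * B * (F * J\<^sub>F) = (1\<^sub>m n + J * B * U * C) * (J + J * (B * F * J\<^sub>F))"
    unfolding R using dims by (simp add: mult_assoc_dim mult_add_distrib_dim)
  then have "?R + ?R * B * (F * J\<^sub>F) = (1\<^sub>m n + J * B * U * C) * J\<^sub>F"
    unfolding F .
  then show "?R \<in> strict_RH_inf"
    by (rule strict_RH_inf_if_add_eq[OF _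
        mult_strict_RH_inf_right[OF RB mult_strict_RH_inf_right[OF RH(3) strict(1)]]
        mult_strict_RH_inf_right[OF add_RH_inf[OF one_mat_RH_inf
          mult_RH_inf[OF strict_RH_inf_imp_RH_inf[OF N] RH(2)]] strict(1)]]) (simp_all add: dims)
qed


section \<open>Passage between SLP and IOP responses\<close>

text \<open>Serves both parts of the theorem: part (2) first produces an SLP solution and then has
  the same controller identity.\<close>

lemma SLP_realization:
  assumes AB: "A \<in> carrier_mat n n" "B \<in> carrier_mat n m" "C \<in> carrier_mat p n"
    and SLP: "SLP_constraints n m p A B C R M N L"
  defines "Y \<equiv> 1\<^sub>m p + const_mat C * N"
  shows "invertible_mat R" and "invertible_mat Y" and "L - M * mat_inv R * N = L * mat_inv Y"
proof -
  let ?X = "zI_minus A" and ?B = "const_mat B" and ?C = "const_mat C"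
  have c: "?X \<in> carrier_mat n n" "?B \<in> carrier_mat n m" "?C \<in> carrier_mat p n"
    using AB by (auto intro: zI_minus_carrier)
  have d: "R \<in> carrier_mat n n" "M \<in> carrier_mat m n" "N \<in> carrier_mat n p" "L \<in> carrier_mat m p"
    and eqs: "?X * R = 1\<^sub>m n + ?B * M" "?X * N = ?B * L" "R * ?X = 1\<^sub>m n + N * ?C" "M * ?X = L * ?C"
    and RH: "R \<in> strict_RH_inf" "M \<in> strict_RH_inf" "N \<in> strict_RH_inf" "L \<in> RH_inf"
    using SLP[unfolded SLP_constraints_iff[OF AB]] by blast+
  note dims = d[THEN carrier_matD(1)] d[THEN carrier_matD(2)]
    c[THEN carrier_matD(1)] c[THEN carrier_matD(2)]
  have "?B * M \<in> strict_RH_inf" and "?C * N \<in> strict_RH_inf"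
    using RH dims by (auto intro!: mult_strict_RH_inf_right const_mat_RH_inf)
  then have strict: "\<And>i j. i < n \<Longrightarrow> j < n \<Longrightarrow> strictly_proper_rat ((?B * M) $$ (i, j))"
    "\<And>i j. i < p \<Longrightarrow> j < p \<Longrightarrow> strictly_proper_rat ((?C * N) $$ (i, j))"
    using strict_RH_infD[of "?B * M"] strict_RH_infD[of "?C * N"] dims by auto
  obtain T where T: "T \<in> carrier_mat n n" "(1\<^sub>m n + ?B * M) * T = 1\<^sub>m n" "T * (1\<^sub>m n + ?B * M) = 1\<^sub>m n"
    using strictly_proper_perturbation_invertible[OF mult_carrier_mat[OF c(2) d(2)] strict(1)] .
  obtain Yi where Yi: "Yi \<in> carrier_mat p p" "Y * Yi = 1\<^sub>m p"
    using strictly_proper_perturbation_invertible[OF mult_carrier_mat[OF c(3) d(3)] strict(2)]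
    unfolding Y_def .
  \<comment> \<open>From XR = I + BM, the inverse \<open>T\<close> of I + BM makes TX a left inverse
    of the square matrix \<open>R\<close>, hence a two-sided one.\<close>
  have "T * ?X * R = 1\<^sub>m n"
    using eqs(1) T dims by (simp add: mult_assoc_dim)
  then have Ri: "T * ?X * R = 1\<^sub>m n" "R * (T * ?X) = 1\<^sub>m n" "T * ?X \<in> carrier_mat n n"
    using mat_mult_left_right_inverse[of "T * ?X" n R] T(1) c(1) d(1) by auto
  note invR = inverse_mat[OF d(1) Ri(3,2)]
  have Y: "Y \<in> carrier_mat p p"
    using c d by (simp add: Y_def)
  note invY = inverse_mat[OF Y Yi]
  show "invertible_mat R" and "invertible_mat Y"
    by (fact invR(1), fact invY(1))
  show "L - M * mat_inv R * N = L * mat_inv Y"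
    unfolding invR(2) invY(2)
    by (rule controller_realizations_eq[OF c(1) d c(3) Ri(3,1) Yi[unfolded Y_def] eqs(3,4)])
qed

text \<open>Solving the constraints by the resolvent \<open>J\<close> expresses \<open>N\<close> and
  \<open>M\<close> through \<open>L\<close>, and \<open>R\<close> in two ways. The form with M
  yields W = PZ, the form with N yields W = YP; stability is inherited through constant
  factors.\<close>

lemma SLP_imp_IOP:
  assumes AB: "A \<in> carrier_mat n n" "B \<in> carrier_mat n m" "C \<in> carrier_mat p n"
    and SLP: "SLP_constraints n m p A B C R M N L"
  shows "IOP_constraints m p (plant A B C) (const_mat C * N + 1\<^sub>m p) L
    (const_mat C * R * const_mat B) (M * const_mat B + 1\<^sub>m m)"
proof -
  let ?X = "zI_minus A" and ?B = "const_mat B" and ?C = "const_mat C"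
  obtain J where J: "J \<in> carrier_mat n n" "?X * J = 1\<^sub>m n" "J * ?X = 1\<^sub>m n"
    by (rule zI_minus_inverse[OF AB(1)]) (rule that)
  have c: "?X \<in> carrier_mat n n" "?B \<in> carrier_mat n m" "?C \<in> carrier_mat p n"
    using AB by (auto intro: zI_minus_carrier)
  have d: "R \<in> carrier_mat n n" "M \<in> carrier_mat m n" "N \<in> carrier_mat n p" "L \<in> carrier_mat m p"
    and eqs: "?X * R = 1\<^sub>m n + ?B * M" "?X * N = ?B * L" "R * ?X = 1\<^sub>m n + N * ?C" "M * ?X = L * ?C"
    and RH: "R \<in> strict_RH_inf" "M \<in> strict_RH_inf" "N \<in> strict_RH_inf" "L \<in> RH_inf"
    using SLP[unfolded SLP_constraints_iff[OF AB]] by blast+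
  note dims = d[THEN carrier_matD(1)] d[THEN carrier_matD(2)] carrier_matD[OF J(1)]
    carrier_matD[OF AB(2)] carrier_matD[OF AB(3)] c[THEN carrier_matD(1)] c[THEN carrier_matD(2)]
  have P: "plant A B C = ?C * J * ?B"
    using inverse_mat(2)[OF c(1) J(1,2)] by (simp add: plant_def)
  have "N = J * (?X * N)"
    using mult_cancel_left_dim[OF J(3), of N] dims by simp
  then have N: "N = J * (?B * L)"
    unfolding eqs(2) .
  have "M = (M * ?X) * J"
    using J(2) dims d(2) by (simp add: mult_assoc_dim)
  then have M: "M = L * ?C * J"
    unfolding eqs(4) .
  have "R = J * (?X * R)"
    using mult_cancel_left_dim[OF J(3), of R] dims by simp
  then have R1: "R = J * (1\<^sub>m n + ?B * M)"
    unfolding eqs(1) .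
  have "R = (R * ?X) * J"
    using J(2) dims d(1) by (simp add: mult_assoc_dim)
  then have R2: "R = (1\<^sub>m n + N * ?C) * J"
    unfolding eqs(3) .
  have Pc: "?C * J * ?B \<in> carrier_mat p m"
    using J(1) c by auto
  have "?C * N + 1\<^sub>m p = 1\<^sub>m p + ?C * J * ?B * L"
    by (subst N) (use dims in \<open>simp add: mult_assoc_dim add_commute_dim\<close>)
  moreover have "M * ?B + 1\<^sub>m m = 1\<^sub>m m + L * (?C * J * ?B)"
    by (subst M) (use dims in \<open>simp add: mult_assoc_dim add_commute_dim\<close>)
  moreover have "?C * R * ?B = ?C * J * ?B * (M * ?B + 1\<^sub>m m)"
    unfolding R1 using dims by (simp add: mat_dim_simps add_commute_dim)
  moreover have "?C * R * ?B = (?C * N + 1\<^sub>m p) * (?C * J * ?B)"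
    unfolding R2 using dims by (simp add: mat_dim_simps add_commute_dim)
  moreover have "?C * N + 1\<^sub>m p \<in> RH_inf"
    by (rule add_RH_inf[OF mult_RH_inf[OF const_mat_RH_inf strict_RH_inf_imp_RH_inf[OF RH(3)]]
        one_mat_RH_inf]) (simp_all add: dims)
  moreover have "?C * R * ?B \<in> RH_inf"
    by (rule mult_RH_inf[OF mult_RH_inf[OF const_mat_RH_inf strict_RH_inf_imp_RH_inf[OF RH(1)]]
        const_mat_RH_inf]) (simp_all add: dims)
  moreover have "M * ?B + 1\<^sub>m m \<in> RH_inf"
    by (rule add_RH_inf[OF mult_RH_inf[OF strict_RH_inf_imp_RH_inf[OF RH(2)] const_mat_RH_inf]
        one_mat_RH_inf]) (simp_all add: dims)
  moreover have "?C * N + 1\<^sub>m p \<in> carrier_mat p p" "?C * R * ?B \<in> carrier_mat p m"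
    "M * ?B + 1\<^sub>m m \<in> carrier_mat m m"
    using c d by auto
  ultimately show ?thesis
    unfolding P IOP_constraints_iff[OF Pc] using RH(4) d(4) by blast
qed

text \<open>The equations follow by cancelling zI - A against its inverse; stability comes from
  \<open>IOP_response_strict\<close>. The second conclusion puts \<open>Y\<close> into the form used
  by \<open>SLP_realization\<close>.\<close>

lemma IOP_imp_SLP:
  assumes AB: "A \<in> carrier_mat n n" "B \<in> carrier_mat n m" "C \<in> carrier_mat p n"
    and stab: "stabilizable A B" and det: "detectable A C"
    and IOP: "IOP_constraints m p (plant A B C) Y U W Z"
  defines "\<Phi> \<equiv> mat_inv (zI_minus A)"
  shows "SLP_constraints n m p A B C (\<Phi> + \<Phi> * const_mat B * U * const_mat C * \<Phi>)
    (U * const_mat C * \<Phi>) (\<Phi> * const_mat B * U) U"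
    and "Y = 1\<^sub>m p + const_mat C * (\<Phi> * const_mat B * U)"
proof -
  let ?X = "zI_minus A" and ?B = "const_mat B" and ?C = "const_mat C"
  have c: "?X \<in> carrier_mat n n" "?B \<in> carrier_mat n m" "?C \<in> carrier_mat p n"
    using AB by (auto intro: zI_minus_carrier)
  obtain J where J': "J \<in> carrier_mat n n" "?X * J = 1\<^sub>m n" "J * ?X = 1\<^sub>m n"
    by (rule zI_minus_inverse[OF AB(1)]) (rule that)
  have "\<Phi> = J"
    unfolding \<Phi>_def by (rule inverse_mat(2)[OF c(1) J'(1,2)])
  with J' have J: "\<Phi> \<in> carrier_mat n n" "?X * \<Phi> = 1\<^sub>m n" "\<Phi> * ?X = 1\<^sub>m n"
    by auto
  have P: "plant A B C = ?C * \<Phi> * ?B"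
    by (simp add: plant_def \<Phi>_def)
  have Pc: "?C * \<Phi> * ?B \<in> carrier_mat p m"
    using c J by auto
  have U: "U \<in> carrier_mat m p"
    and Y: "Y = 1\<^sub>m p + ?C * \<Phi> * ?B * U"
    and WZ: "W = ?C * \<Phi> * ?B * Z" "Z = 1\<^sub>m m + U * (?C * \<Phi> * ?B)"
    and RH: "Y \<in> RH_inf" "U \<in> RH_inf" "W \<in> RH_inf" "Z \<in> RH_inf"
    using IOP[unfolded P IOP_constraints_iff[OF Pc]] by blast+
  note dims = carrier_matD[OF U] carrier_matD[OF J(1)] c[THEN carrier_matD(1)] c[THEN carrier_matD(2)]
  obtain F where F: "F \<in> carrier_mat m n" "schur_stable (A + B * F)"
    using stab AB by (auto simp: stabilizable_def)
  obtain K where K: "K \<in> carrier_mat n p" "schur_stable (A + K * C)"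
    using det AB by (auto simp: detectable_def)
  have BF: "B * F \<in> carrier_mat n n" "A + B * F \<in> carrier_mat n n"
    and KC: "K * C \<in> carrier_mat n n" "A + K * C \<in> carrier_mat n n"
    using AB F(1) K(1) by auto
  obtain J\<^sub>F where JF: "J\<^sub>F \<in> carrier_mat n n" "zI_minus (A + B * F) * J\<^sub>F = 1\<^sub>m n" "J\<^sub>F \<in> strict_RH_inf"
    by (rule zI_minus_inverse[OF BF(2)]) (rule that; simp add: F(2))
  obtain J\<^sub>K where JK: "J\<^sub>K \<in> carrier_mat n n" "J\<^sub>K * zI_minus (A + K * C) = 1\<^sub>m n" "J\<^sub>K \<in> strict_RH_inf"
    by (rule zI_minus_inverse[OF KC(2)]) (rule that; simp add: K(2))
  have FK: "const_mat F \<in> carrier_mat m n" "const_mat K \<in> carrier_mat n p"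
    using F(1) K(1) by auto
  have "\<Phi> + \<Phi> * (const_mat (B * F) * J\<^sub>F) = J\<^sub>F"
    by (rule shifted_inverse_right[OF zI_minus_add[OF AB(1) BF(1)] J(3) JF(2) c(1)
        zI_minus_carrier[OF BF(2)] _ J(1) JF(1)]) (use BF in auto)
  then have idF: "\<Phi> + \<Phi> * (?B * const_mat F * J\<^sub>F) = J\<^sub>F"
    unfolding const_mat_hom[OF AB(2) F(1)] .
  have "\<Phi> + J\<^sub>K * (const_mat (K * C) * \<Phi>) = J\<^sub>K"
    by (rule shifted_inverse_left[OF zI_minus_add[OF AB(1) KC(1)] J(2) JK(2) c(1)
        zI_minus_carrier[OF KC(2)] _ J(1) JK(1)]) (use KC in auto)
  then have idK: "\<Phi> + J\<^sub>K * (const_mat K * ?C * \<Phi>) = J\<^sub>K"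
    unfolding const_mat_hom[OF K(1) AB(3)] .
  \<comment> \<open>The memberships of \<open>Y\<close>, \<open>Z\<close> and \<open>W\<close> enter
    after rewriting these matrices as expressions in \<open>U\<close> and the plant.\<close>
  note strict = IOP_response_strict[OF J(1) JF(1) JK(1) c(2,3) FK U idF idK JF(3) JK(3)
      const_mat_RH_inf const_mat_RH_inf const_mat_RH_inf const_mat_RH_inf RH(2) RH(1)[unfolded Y] RH(4)[unfolded WZ(2)]
      RH(3)[unfolded WZ(1), unfolded WZ(2)]]
  let ?R = "\<Phi> + \<Phi> * ?B * U * ?C * \<Phi>" and ?M = "U * ?C * \<Phi>" and ?N = "\<Phi> * ?B * U"
  \<comment> \<open>Cancels at the front of right-associated products; at their end the pair
    \<open>\<Phi> * ?X\<close> stands alone and is rewritten by \<open>J(3)\<close>.\<close>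
  have cancel: "?X * (\<Phi> * V) = V" if "dim_row V = n" for V
    using mult_cancel_left_dim[OF J(2)] that dims by simp
  have "?X * ?R = 1\<^sub>m n + ?B * ?M" "?X * ?N = ?B * U" "?R * ?X = 1\<^sub>m n + ?N * ?C" "?M * ?X = U * ?C"
    using dims J c U by (simp_all add: mat_dim_simps cancel)
  moreover have "?R \<in> carrier_mat n n" "?M \<in> carrier_mat m n" "?N \<in> carrier_mat n p"
    using dims by auto
  ultimately show "SLP_constraints n m p A B C ?R ?M ?N U"
    unfolding SLP_constraints_iff[OF AB] using strict RH(2) U by blast
  show "Y = 1\<^sub>m p + ?C * ?N"
    unfolding Y using dims by (simp add: mult_assoc_dim)
qed

theorem theorem2:
  fixes A B\<^sub>2 C\<^sub>2 :: "real mat" and n m p :: nat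
  assumes "A \<in> carrier_mat n n" and "B\<^sub>2 \<in> carrier_mat n m" and "C\<^sub>2 \<in> carrier_mat p n"
    and "stabilizable A B\<^sub>2" and "detectable A C\<^sub>2"
  defines "P\<^sub>2\<^sub>2 \<equiv> plant A B\<^sub>2 C\<^sub>2"
    and "\<Phi> \<equiv> mat_inv (zI_minus A)"
    and "B \<equiv> const_mat B\<^sub>2"
    and "C \<equiv> const_mat C\<^sub>2"
  shows "invertible_mat (zI_minus A) \<and>
    (\<forall>R M N L Y U W Z.
      SLP_constraints n m p A B\<^sub>2 C\<^sub>2 R M N L \<longrightarrow>
      Y = C * N + 1\<^sub>m p \<longrightarrow> U = L \<longrightarrow> W = C * R * B \<longrightarrow> Z = M * B + 1\<^sub>m m \<longrightarrow>
      IOP_constraints m p P\<^sub>2\<^sub>2 Y U W Z \<and>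
      invertible_mat R \<and> invertible_mat Y \<and>
      L - M * mat_inv R * N = U * mat_inv Y) \<and>
    (\<forall>Y U W Z R M N L.
      IOP_constraints m p P\<^sub>2\<^sub>2 Y U W Z \<longrightarrow>
      R = \<Phi> + \<Phi> * B * U * C * \<Phi> \<longrightarrow> M = U * C * \<Phi> \<longrightarrow> N = \<Phi> * B * U \<longrightarrow> L = U \<longrightarrow>
      SLP_constraints n m p A B\<^sub>2 C\<^sub>2 R M N L \<and>
      invertible_mat R \<and> invertible_mat Y \<and>
      U * mat_inv Y = L - M * mat_inv R * N)"
proof (intro conjI allI impI)
  obtain J where "J \<in> carrier_mat n n" "zI_minus A * J = 1\<^sub>m n"
    by (rule zI_minus_inverse[OF assms(1)]) (rule that)
  then show "invertible_mat (zI_minus A)"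
    using inverse_mat(1)[OF zI_minus_carrier[OF assms(1)]] by blast
next
  fix R M N L Y U W Z
  assume SLP: "SLP_constraints n m p A B\<^sub>2 C\<^sub>2 R M N L"
    and eqs: "Y = C * N + 1\<^sub>m p" "U = L" "W = C * R * B" "Z = M * B + 1\<^sub>m m"
  show "IOP_constraints m p P\<^sub>2\<^sub>2 Y U W Z"
    unfolding eqs P\<^sub>2\<^sub>2_def B_def C_def by (rule SLP_imp_IOP[OF assms(1-3) SLP])
  \<comment> \<open>Only the order of the summands changes, to match
    \<open>SLP_realization\<close>.\<close>
  have "Y = 1\<^sub>m p + const_mat C\<^sub>2 * N"
    using SLP assms(3) unfolding eqs C_def
    by (intro add_commute_dim) (auto simp: SLP_constraints_def)
  then show "invertible_mat R" "invertible_mat Y" "L - M * mat_inv R * N = U * mat_inv Y"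
    using SLP_realization[OF assms(1-3) SLP] \<open>U = L\<close> by simp_all
next
  fix Y U W Z R M N L
  assume IOP: "IOP_constraints m p P\<^sub>2\<^sub>2 Y U W Z"
    and eqs: "R = \<Phi> + \<Phi> * B * U * C * \<Phi>" "M = U * C * \<Phi>" "N = \<Phi> * B * U" "L = U"
  note * = IOP_imp_SLP[OF assms(1-5) IOP[unfolded P\<^sub>2\<^sub>2_def],
      folded \<Phi>_def B_def C_def, folded eqs(1-3)]
  show SLP: "SLP_constraints n m p A B\<^sub>2 C\<^sub>2 R M N L"
    using *(1) eqs(4) by simp
  \<comment> \<open>The constructed matrices satisfy the SLP constraints and Y = I + CN, so the
    controller identity for SLP solutions applies.\<close>
  show "invertible_mat R" "invertible_mat Y" "U * mat_inv Y = L - M * mat_inv R * N"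
    using SLP_realization[OF assms(1-3) SLP] *(2) eqs(4) unfolding C_def by simp_all
qed

end
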